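(* Let $q\in\mathbb{C}$ with $0<|q|<1$. Let $f(a,b,c)$ be a function of three complex variables that is analytic in a neighborhood of $(a,b,c)=(0,0,0)\in\mathbb{C}^3$ and satisfies there the $q$-functional equation $$c\big(f(a,bq,cq)-f(a,b,cq)\big)=b\big(f(a,bq,cq)-f(a,bq,c)-af(a,b,c)+af(a,b,cq)\big).$$ Then, for $(a,b,c)$ near $(0,0,0)$ with $a\neq 0$, $$f(a,b,c)=T\!\left(-\tfrac1a,ab;\theta\right)\{f(a,0,c)\}=\sum_{n=0}^{\infty}\frac{(-1/a;q)_n}{(q;q)_n}\,(ab)^n\,\theta^n\{f(a,0,c)\},$$ where $\theta$ (and hence $T(-\frac1a,ab;\theta)$) acts with respect to the variable $c$.
   Context: The $q$-shifted factorials are $(x;q)_0=1$ and $(x;q)_n=(1-x)(1-xq)\cdots(1-xq^{n-1})$ for $n\ge 1$. Acting on functions $g$ of the variable $c$: $D_q\{g(c)\}=\dfrac{g(c)-g(cq)}{c}$ (with no factor $1-q$ in the denominator), $\eta^{-1}\{g(c)\}=g(q^{-1}c)$, and $\theta=\eta^{-1}D_q$, i.e. $\theta\{g(c)\}=\dfrac{g(q^{-1}c)-g(c)}{q^{-1}c}$; $\theta^0$ is the identity and $\theta^n\{g(c)\}=\theta\{\theta^{n-1}\{g(c)\}\}$. For $g$ analytic near $0$, $\theta$ is understood as acting on the Taylor series of $g$ at $c=0$: $\theta\{\sum_{k\ge0}\alpha_kc^k\}=\sum_{k\ge1}\alpha_k(1-q^k)q^{1-k}c^{k-1}$, and $\theta^n\{g(c)\}$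 denotes the sum of the resulting series. The operator $T(x,y;\theta)=\sum_{n\ge0}\frac{(x;q)_n}{(q;q)_n}(y\theta)^n$ acts on a function $g(c)$ by $T(x,y;\theta)\{g(c)\}=\sum_{n\ge0}\frac{(x;q)_n}{(q;q)_n}y^n\theta^n\{g(c)\}$; here $x$ and $y$ (in particular $a$ and $b$) are treated as constants. *)

theory Defs
  imports "HOL-Complex_Analysis.Complex_Analysis"
begin

definition qpoch :: "complex \<Rightarrow> complex \<Rightarrow> nat \<Rightarrow> complex" where
  "qpoch x q n = (\<Prod>k<n. (1 - x * q ^ k))"

text \<open>
  Analyticity of a function of three complex variables: around every point of the set the function
  is the sum of a triple power series, convergent on a polydisc.  Here \<open>has_sum\<close> is unordered
  (hence absolute) summation over all triples of exponents.
\<close>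

definition analytic3_at ::
  "(complex \<Rightarrow> complex \<Rightarrow> complex \<Rightarrow> complex) \<Rightarrow> complex \<times> complex \<times> complex \<Rightarrow> bool" where
  "analytic3_at f = (\<lambda>(a0, b0, c0).
     \<exists>(A :: nat \<Rightarrow> nat \<Rightarrow> nat \<Rightarrow> complex) r. r > 0 \<and>
       (\<forall>a b c. norm (a - a0) < r \<and> norm (b - b0) < r \<and> norm (c - c0) < r \<longrightarrow>
          ((\<lambda>(i, j, k). A i j k * (a - a0) ^ i * (b - b0) ^ j * (c - c0) ^ k)
             has_sum f a b c) UNIV))"

definition analytic3_on ::
  "(complex \<Rightarrow> complex \<Rightarrow> complex \<Rightarrow> complex) \<Rightarrow> (complex \<times> complex \<times> complex) set \<Rightarrow> bool" where
  "analytic3_on f U \<longleftrightarrow> (\<forall>p\<in>U. analytic3_at f p)"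

definition q_diff :: "complex \<Rightarrow> (complex \<Rightarrow> complex) \<Rightarrow> complex \<Rightarrow> complex" where
  "q_diff q g = (\<lambda>c. (g c - g (c * q)) / c)"

definition eta_inv :: "complex \<Rightarrow> (complex \<Rightarrow> complex) \<Rightarrow> complex \<Rightarrow> complex" where
  "eta_inv q g = (\<lambda>c. g (c / q))"

text \<open>
  The action of \<open>\<theta> = \<eta>\<^sup>-\<^sup>1 D\<^sub>q\<close> on power series,
  \<open>\<theta> (\<Sum>k\<ge>0. \<alpha>\<^sub>k c\<^sup>k) = (\<Sum>k\<ge>1. \<alpha>\<^sub>k (1 - q\<^sup>k) q\<^sup>1\<^sup>-\<^sup>k c\<^sup>k\<^sup>-\<^sup>1)\<close>, with the index
  shifted by one.
\<close>

definition fps_theta :: "complex \<Rightarrow> complex fps \<Rightarrow> complex fps" where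
  "fps_theta q F = Abs_fps (\<lambda>k. fps_nth F (Suc k) * (1 - q ^ Suc k) / q ^ k)"

lemma fps_theta_conv_q_diff:
  assumes "q \<noteq> 0" "norm q < 1" "c \<noteq> 0" "ereal (norm (c / q)) < fps_conv_radius F"
  shows "eval_fps (fps_theta q F) c = eta_inv q (q_diff q (eval_fps F)) c"
proof -
  have "norm c * norm q \<le> norm c * 1"
    by (rule mult_left_mono) (use assms in auto)
  hence "norm c \<le> norm (c / q)"
    using assms by (simp add: norm_divide field_simps)
  hence c: "ereal (norm c) < fps_conv_radius F"
    using assms(4) by (metis ereal_less_eq(3) le_less_trans)
  have "(\<lambda>k. fps_nth F k * (c / q) ^ k - fps_nth F k * c ^ k)
          sums (eval_fps F (c / q) - eval_fps F c)"
    by (intro sums_diff sums_eval_fps assms c)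
  hence "(\<lambda>k. fps_nth F (Suc k) * (c / q) ^ Suc k - fps_nth F (Suc k) * c ^ Suc k)
          sums (eval_fps F (c / q) - eval_fps F c)"
    by (subst sums_Suc_iff) simp
  hence "(\<lambda>k. (fps_nth F (Suc k) * (c / q) ^ Suc k - fps_nth F (Suc k) * c ^ Suc k) / (c / q))
          sums ((eval_fps F (c / q) - eval_fps F c) / (c / q))"
    by (rule sums_divide)
  also have "(\<lambda>k. (fps_nth F (Suc k) * (c / q) ^ Suc k - fps_nth F (Suc k) * c ^ Suc k) / (c / q))
               = (\<lambda>k. fps_nth (fps_theta q F) k * c ^ k)"
    using assms by (auto simp: fun_eq_iff fps_theta_def field_simps)
  finally show ?thesis
    using assms by (simp add: eval_fps_def sums_iff eta_inv_def q_diff_def)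
qed

text \<open>
  \<open>\<theta>\<^sup>n g\<close> is computed on the Taylor series of \<open>g\<close> at \<open>0\<close>, and then summed.  Like every
  \<open>suminf\<close>, this is meaningful only where the resulting series converges.
\<close>

definition theta_series :: "complex \<Rightarrow> nat \<Rightarrow> (complex \<Rightarrow> complex) \<Rightarrow> complex fps" where
  "theta_series q n g = (fps_theta q ^^ n) (fps_expansion g 0)"

definition theta_pow :: "complex \<Rightarrow> nat \<Rightarrow> (complex \<Rightarrow> complex) \<Rightarrow> complex \<Rightarrow> complex" where
  "theta_pow q n g c = eval_fps (theta_series q n g) c"

definition T_op ::
  "complex \<Rightarrow> complex \<Rightarrow> complex \<Rightarrow> (complex \<Rightarrow> complex) \<Rightarrow> complex \<Rightarrow> complex" where
  "T_op q x y g c = (\<Sum>n. qpoch x q n / qpoch q q n * y ^ n * theta_pow q n g c)"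

end

(*
  Fix a and write f(a,b,c) = sum_{n,k} B_{n,k} b^n c^k. Comparing coefficients in the functional
  equation gives B_{n+1,k} (1 - q^(n+1)) = (a + q^n) (theta B_n)_k, hence
  B_n = prod_{m<n} (a + q^m) / (q;q)_n * theta^n B_0, and prod_{m<n} (a + q^m) = a^n (-1/a;q)_n.

  The delicate point is the convergence of theta^n B_0 at a fixed c for all n, because B_n says
  nothing about theta^n B_0 when a = -q^m with m < n. The relation
  B_{n,0} prod_{m<n} q^m = B_{0,n} prod_{m<n} (a + q^m) shows that B_{0,n}(a) is of order
  |q|^(n(n-1)/2) K^n on a circle |a| = rho that avoids all |q|^m, and by the maximum modulus
  principle also inside it. So B_0 is entire in c, and theta preserves this.
*)

theory Submission
  imports Defs
begin

section \<open>Power series in one and three variables\<close>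

lemma powser_coeffs_unique:
  fixes a b :: "nat \<Rightarrow> complex"
  assumes "r > 0"
    and "\<And>z. norm z < r \<Longrightarrow> (\<lambda>n. a n * z ^ n) sums f z"
    and "\<And>z. norm z < r \<Longrightarrow> (\<lambda>n. b n * z ^ n) sums f z"
  shows "a = b"
proof -
  have ev: "eventually (\<lambda>z. norm z < r) (nhds (0::complex))"
    using assms(1) eventually_nhds_metric[of _ "0::complex"] by auto
  have "f has_fps_expansion Abs_fps a" "f has_fps_expansion Abs_fps b"
    by (rule has_fps_expansionI; rule eventually_mono[OF ev]; use assms in simp)+
  hence "Abs_fps a = Abs_fps b"
    by (rule fps_expansion_unique_complex)
  thus ?thesis
    by (metis fps_nth_Abs_fps ext)
qed

lemma powser_mult_var_sums:
  fixes a :: "nat \<Rightarrow> complex"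
  assumes "(\<lambda>n. a n * z ^ n) sums s"
  shows "(\<lambda>n. (case n of 0 \<Rightarrow> 0 | Suc m \<Rightarrow> a m) * z ^ n) sums (z * s)"
proof -
  have "(\<lambda>n. z * (a n * z ^ n)) sums (z * s)"
    by (rule sums_mult[OF assms])
  hence "(\<lambda>n. (case Suc n of 0 \<Rightarrow> 0 | Suc m \<Rightarrow> a m) * z ^ Suc n) sums (z * s)"
    by (simp add: mult_ac)
  thus ?thesis
    by (subst (asm) sums_Suc_iff) simp
qed

text \<open>Fubini for an absolutely convergent triple sum. The exponent of \<open>a\<close> is
  summed innermost because \<open>a\<close> is a mere parameter of the functional equation; this
  also exhibits \<open>B a j k\<close> as a power series in \<open>a\<close>, hence as a holomorphic
  function to which the maximum modulus principle applies.\<close>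

lemma triple_power_series_iterated:
  fixes A :: "nat \<Rightarrow> nat \<Rightarrow> nat \<Rightarrow> complex"
  assumes r: "r > 0"
    and f: "\<And>a b c. norm a < r \<Longrightarrow> norm b < r \<Longrightarrow> norm c < r \<Longrightarrow>
              ((\<lambda>(i, j, k). A i j k * a ^ i * b ^ j * c ^ k) has_sum f a b c) UNIV"
  obtains B G where
    "\<And>a j k. norm a < r \<Longrightarrow> (\<lambda>i. A i j k * a ^ i) sums B a j k"
    "\<And>a j c. norm a < r \<Longrightarrow> norm c < r \<Longrightarrow> (\<lambda>k. B a j k * c ^ k) sums G a j c"
    "\<And>a b c. norm a < r \<Longrightarrow> norm b < r \<Longrightarrow> norm c < r \<Longrightarrow> (\<lambda>j. G a j c * b ^ j) sums f a b c"
proof -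
  \<comment> \<open>\<open>B\<close> may not depend on \<open>b\<close> and \<open>c\<close>, nor
    \<open>G\<close> on \<open>b\<close>. Their summability is read off from the triple sum with the
    outer variables set to \<open>s\<close>, which is nonzero so that \<open>s ^ j\<close> and
    \<open>s ^ k\<close> can be divided out.\<close>
  define s :: complex where "s = of_real (r / 2)"
  have s: "s \<noteq> 0" "norm s < r"
    using r by (auto simp: s_def)
  define B where "B = (\<lambda>a j k. infsum (\<lambda>i. A i j k * a ^ i) UNIV)"
  define G where "G = (\<lambda>a j c. infsum (\<lambda>(k, i). A i j k * a ^ i * c ^ k) UNIV)"
  have 1: "((\<lambda>(j, k, i). A i j k * a ^ i * b ^ j * c ^ k) has_sum f a b c) (UNIV \<times> UNIV)"
    if "norm a < r" "norm b < r" "norm c < r" for a b c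
  proof -
    have "((\<lambda>(j, k, i). A i j k * a ^ i * b ^ j * c ^ k) has_sum f a b c) UNIV \<longleftrightarrow>
          ((\<lambda>(i, j, k). A i j k * a ^ i * b ^ j * c ^ k) has_sum f a b c) UNIV"
      by (rule has_sum_reindex_bij_witness[of _ "\<lambda>(i, j, k). (j, k, i)" "\<lambda>(j, k, i). (i, j, k)"]) auto
    thus ?thesis
      using f[OF that] by simp
  qed
  have 2: "(\<lambda>(k, i). A i j k * a ^ i * c ^ k) summable_on (UNIV \<times> UNIV)"
    if "norm a < r" "norm c < r" for a c j
  proof -
    have "(\<lambda>(j, x). (case x of (k, i) \<Rightarrow> A i j k * a ^ i * s ^ j * c ^ k)) summable_on (UNIV \<times> UNIV)"
      using 1[OF that(1) s(2) that(2)] by (auto simp: summable_on_def)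
    hence "(\<lambda>x. (case x of (k, i) \<Rightarrow> A i j k * a ^ i * s ^ j * c ^ k)) summable_on UNIV"
      by (rule summable_on_SigmaD1) auto
    hence "(\<lambda>x. inverse (s ^ j) * (case x of (k, i) \<Rightarrow> A i j k * a ^ i * s ^ j * c ^ k)) summable_on UNIV"
      by (rule summable_on_cmult_right)
    also have "(\<lambda>x. inverse (s ^ j) * (case x of (k, i) \<Rightarrow> A i j k * a ^ i * s ^ j * c ^ k)) =
               (\<lambda>(k, i). A i j k * a ^ i * c ^ k)"
      using s by (auto simp: fun_eq_iff field_simps)
    finally show ?thesis by simp
  qed
  have 3: "((\<lambda>i. A i j k * a ^ i) has_sum B a j k) UNIV" if "norm a < r" for a j k
  proof -
    have "(\<lambda>i. A i j k * a ^ i * s ^ k) summable_on UNIV"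
      using summable_on_SigmaD1[OF 2[OF that s(2)], of k] by simp
    hence "(\<lambda>i. inverse (s ^ k) * (A i j k * a ^ i * s ^ k)) summable_on UNIV"
      by (rule summable_on_cmult_right)
    also have "(\<lambda>i. inverse (s ^ k) * (A i j k * a ^ i * s ^ k)) = (\<lambda>i. A i j k * a ^ i)"
      using s by (auto simp: fun_eq_iff field_simps)
    finally show ?thesis
      unfolding B_def by (rule has_sum_infsum)
  qed
  have G: "((\<lambda>(k, i). A i j k * a ^ i * c ^ k) has_sum G a j c) (UNIV \<times> UNIV)"
    if "norm a < r" "norm c < r" for a c j
    using has_sum_infsum[OF 2[OF that]] by (simp add: G_def)
  have 4: "((\<lambda>k. B a j k * c ^ k) has_sum G a j c) UNIV" if "norm a < r" "norm c < r" for a c j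
    by (rule has_sum_SigmaD[OF G[OF that]]) (use 3[OF that(1)] in \<open>auto intro: has_sum_cmult_left\<close>)
  have 5: "((\<lambda>j. G a j c * b ^ j) has_sum f a b c) UNIV"
    if "norm a < r" "norm b < r" "norm c < r" for a b c
  proof (rule has_sum_SigmaD[OF 1[OF that]])
    fix j
    have "((\<lambda>x. (case x of (k, i) \<Rightarrow> A i j k * a ^ i * c ^ k) * b ^ j) has_sum (G a j c * b ^ j)) UNIV"
      using has_sum_cmult_left[OF G[OF that(1,3)]] by simp
    also have "(\<lambda>x. (case x of (k, i) \<Rightarrow> A i j k * a ^ i * c ^ k) * b ^ j) =
               (\<lambda>(k, i). A i j k * a ^ i * b ^ j * c ^ k)"
      by (auto simp: fun_eq_iff)
    finally show "((\<lambda>y. case (j, y) of (j, k, i) \<Rightarrow> A i j k * a ^ i * b ^ j * c ^ k)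
                     has_sum G a j c * b ^ j) UNIV"
      by simp
  qed
  show ?thesis
    using 3 4 5 by (intro that[of B G] has_sum_imp_sums)
qed

text \<open>Finite partial sums of the absolute values are bounded, in particular those over
  singletons. This plays the part of Cauchy's inequalities, for all coefficients at once.\<close>

lemma triple_power_series_coeff_bound:
  fixes A :: "nat \<Rightarrow> nat \<Rightarrow> nat \<Rightarrow> complex"
  assumes "((\<lambda>(i, j, k). A i j k * x ^ i * y ^ j * z ^ k) has_sum S) UNIV"
  obtains M where "\<And>i j k. norm (A i j k * x ^ i * y ^ j * z ^ k) \<le> M"
proof -
  let ?t = "\<lambda>(i, j, k). A i j k * x ^ i * y ^ j * z ^ k"
  have "(\<lambda>p. norm (?t p)) summable_on UNIV"
    using assms summable_on_iff_abs_summable_on_complex by (auto simp: summable_on_def)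
  then obtain M where M: "\<And>F. finite F \<Longrightarrow> sum (\<lambda>p. norm (?t p)) F \<le> M"
    unfolding Infinite_Sum.abs_summable_iff_bdd_above bdd_above_def by auto
  show ?thesis
    by (rule that[of M]) (use M[of "{(i, j, k)}" for i j k] in simp)
qed

section \<open>The recurrence for the coefficients and its solution\<close>

text \<open>Coefficients are compared in \<open>b\<close> for fixed \<open>c\<close>, and then in
  \<open>c\<close>. The bare factors \<open>b\<close> and \<open>c\<close> of the equation each
  shift an index by one, so raising \<open>j\<close> is tied to lowering \<open>k\<close>; the
  right-hand side is \<open>a + q ^ j\<close> times a coefficient of theta applied to
  \<open>B j\<close>.\<close>

lemma q_functional_equation_coeffs:
  fixes q a :: complex
  assumes r: "r > 0" and q: "norm q < 1" "q \<noteq> 0"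
    and B: "\<And>j c. norm c < r \<Longrightarrow> (\<lambda>k. B j k * c ^ k) sums G j c"
    and G: "\<And>b c. norm b < r \<Longrightarrow> norm c < r \<Longrightarrow> (\<lambda>j. G j c * b ^ j) sums F b c"
    and F: "\<And>b c. norm b < r \<Longrightarrow> norm c < r \<Longrightarrow>
              c * (F (b * q) (c * q) - F b (c * q)) =
              b * (F (b * q) (c * q) - F (b * q) c - a * F b c + a * F b (c * q))"
  shows "B (Suc j) k * (1 - q ^ Suc j) = B j (Suc k) * (1 - q ^ Suc k) / q ^ k * (a + q ^ j)"
proof -
  have small: "norm (z * q) < r" if "norm z < r" for z :: complex
  proof -
    have "norm z * norm q \<le> norm z * 1"
      by (rule mult_left_mono) (use q in auto)
    thus ?thesis using that by (simp add: norm_mult)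
  qed
  \<comment> \<open>The coefficient of \<open>b ^ Suc j\<close>: the four terms on the right
    collapse to the common factor \<open>q ^ j + a\<close>.\<close>
  have 1: "c * ((q ^ Suc j - 1) * G (Suc j) (c * q)) = - (q ^ j + a) * (G j c - G j (c * q))"
    if c: "norm c < r" for c
  proof -
    define H where "H = (\<lambda>j. G j (c * q) * q ^ j - G j c * q ^ j - a * G j c + a * G j (c * q))"
    have "(\<lambda>j. c * (q ^ j - 1) * G j (c * q)) = (\<lambda>j. case j of 0 \<Rightarrow> 0 | Suc m \<Rightarrow> H m)"
    proof (rule powser_coeffs_unique[OF r, where f = "\<lambda>b. c * (F (b * q) (c * q) - F b (c * q))"])
      fix b :: complex assume b: "norm b < r"
      have "(\<lambda>j. c * (G j (c * q) * (b * q) ^ j - G j (c * q) * b ^ j)) sums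
              (c * (F (b * q) (c * q) - F b (c * q)))"
        by (intro sums_mult sums_diff G small b c)
      thus "(\<lambda>j. c * (q ^ j - 1) * G j (c * q) * b ^ j) sums (c * (F (b * q) (c * q) - F b (c * q)))"
        by (simp add: power_mult_distrib algebra_simps)
      have "(\<lambda>j. G j (c * q) * (b * q) ^ j - G j c * (b * q) ^ j - a * (G j c * b ^ j) +
                  a * (G j (c * q) * b ^ j)) sums
              (F (b * q) (c * q) - F (b * q) c - a * F b c + a * F b (c * q))"
        by (intro sums_add sums_mult sums_diff G small b c)
      hence "(\<lambda>j. H j * b ^ j) sums (F (b * q) (c * q) - F (b * q) c - a * F b c + a * F b (c * q))"
        by (simp add: H_def power_mult_distrib algebra_simps)
      from powser_mult_var_sums[OF this]
      show "(\<lambda>j. (case j of 0 \<Rightarrow> 0 | Suc m \<Rightarrow> H m) * b ^ j) sums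
              (c * (F (b * q) (c * q) - F b (c * q)))"
        by (simp only: F[OF b c])
    qed
    from fun_cong[OF this, of "Suc j"] show ?thesis
      by (simp add: H_def algebra_simps)
  qed
  \<comment> \<open>Both sides of \<open>1\<close> as power series in \<open>c\<close>. At index 0
    both coefficients vanish, so the information sits at \<open>Suc k\<close>.\<close>
  have "(\<lambda>k. case k of 0 \<Rightarrow> 0 | Suc m \<Rightarrow> (q ^ Suc j - 1) * (B (Suc j) m * q ^ m)) =
        (\<lambda>k. - (q ^ j + a) * (B j k * (1 - q ^ k)))"
  proof (rule powser_coeffs_unique[OF r, where f = "\<lambda>c. - (q ^ j + a) * (G j c - G j (c * q))"])
    fix c :: complex assume c: "norm c < r"
    have "(\<lambda>k. (q ^ Suc j - 1) * (B (Suc j) k * (c * q) ^ k)) sums ((q ^ Suc j - 1) * G (Suc j) (c * q))"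
      by (intro sums_mult B small c)
    hence "(\<lambda>k. ((q ^ Suc j - 1) * (B (Suc j) k * q ^ k)) * c ^ k) sums ((q ^ Suc j - 1) * G (Suc j) (c * q))"
      by (simp add: power_mult_distrib mult_ac)
    from powser_mult_var_sums[OF this]
    show "(\<lambda>k. (case k of 0 \<Rightarrow> 0 | Suc m \<Rightarrow> (q ^ Suc j - 1) * (B (Suc j) m * q ^ m)) * c ^ k) sums
            (- (q ^ j + a) * (G j c - G j (c * q)))"
      by (simp only: 1[OF c])
    have "(\<lambda>k. - (q ^ j + a) * (B j k * c ^ k - B j k * (c * q) ^ k)) sums
            (- (q ^ j + a) * (G j c - G j (c * q)))"
      by (intro sums_mult sums_diff B small c)
    also have "(\<lambda>k. - (q ^ j + a) * (B j k * c ^ k - B j k * (c * q) ^ k)) =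
               (\<lambda>k. - (q ^ j + a) * (B j k * (1 - q ^ k)) * c ^ k)"
      by (simp add: fun_eq_iff power_mult_distrib algebra_simps)
    finally show "(\<lambda>k. - (q ^ j + a) * (B j k * (1 - q ^ k)) * c ^ k) sums
            (- (q ^ j + a) * (G j c - G j (c * q)))" .
  qed
  from fun_cong[OF this, of "Suc k"]
  have "(q ^ Suc j - 1) * (B (Suc j) k * q ^ k) = - (q ^ j + a) * (B j (Suc k) * (1 - q ^ Suc k))"
    by simp
  hence "B (Suc j) k * (1 - q ^ Suc j) * q ^ k = B j (Suc k) * (1 - q ^ Suc k) * (a + q ^ j)"
    by (simp add: algebra_simps)
  thus ?thesis
    using q(2) by (simp add: nonzero_eq_divide_eq)
qed

lemma one_minus_power_nonzero:
  fixes q :: complex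
  assumes "norm q < 1"
  shows "1 - q ^ Suc n \<noteq> 0"
proof
  assume "1 - q ^ Suc n = 0"
  hence "norm (q ^ Suc n) = 1" by simp
  moreover have "norm q ^ Suc n \<le> norm q ^ 1"
    using assms by (intro power_decreasing) auto
  ultimately show False using assms by (simp only: norm_power power_one_right)
qed

lemma qpoch_q_q_eq: "qpoch q q n = (\<Prod>m<n. 1 - q ^ Suc m)"
  by (simp add: qpoch_def)

text \<open>Induction divides by \<open>1 - q ^ Suc n\<close> but never by \<open>a + q ^ n\<close>.
  The formula therefore covers the points \<open>a = - (q ^ m)\<close>, where the product vanishes
  for all \<open>n > m\<close>.\<close>

lemma theta_recurrence_solution:
  fixes q a :: complex
  assumes q: "norm q < 1"
    and rec: "\<And>j k. B (Suc j) k * (1 - q ^ Suc j) =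
                      B j (Suc k) * (1 - q ^ Suc k) / q ^ k * (a + q ^ j)"
  shows "B n k = (\<Prod>m<n. a + q ^ m) / qpoch q q n * fps_nth ((fps_theta q ^^ n) (Abs_fps (B 0))) k"
proof (induction n arbitrary: k)
  case 0
  show ?case by (simp add: qpoch_def)
next
  case (Suc n)
  have "B (Suc n) k = B n (Suc k) * (1 - q ^ Suc k) / q ^ k * (a + q ^ n) / (1 - q ^ Suc n)"
    using rec[of n k] one_minus_power_nonzero[OF q, of n]
    by (metis nonzero_mult_div_cancel_right)
  also have "\<dots> = (\<Prod>m<Suc n. a + q ^ m) / (qpoch q q n * (1 - q ^ Suc n)) *
      (fps_nth ((fps_theta q ^^ n) (Abs_fps (B 0))) (Suc k) * (1 - q ^ Suc k) / q ^ k)"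
    unfolding Suc.IH by (simp add: mult_ac)
  also have "qpoch q q n * (1 - q ^ Suc n) = qpoch q q (Suc n)"
    by (simp add: qpoch_q_q_eq)
  finally show ?case
    by (simp add: fps_theta_def)
qed

section \<open>Iterates of theta: constant terms and convergence\<close>

text \<open>Each theta lowers the index by one, so the constant term sees only coefficient
  \<open>n\<close> of \<open>F\<close>. The small denominator is what later turns a bound for
  \<open>B a n 0\<close> into rapid decay of \<open>B a 0 n\<close>.\<close>

lemma fps_theta_funpow_nth_0:
  "fps_nth ((fps_theta q ^^ n) F) 0 = fps_nth F n * qpoch q q n / (\<Prod>m<n. q ^ m)"
proof -
  \<comment> \<open>General \<open>k\<close> is needed because the outermost theta calls for the
    induction hypothesis at \<open>Suc k\<close>.\<close>
  have "fps_nth ((fps_theta q ^^ n) F) k = fps_nth F (n + k) * (\<Prod>i<n. (1 - q ^ Suc (k + i)) / q ^ (k + i))" for k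
  proof (induction n arbitrary: k)
    case (Suc n)
    have "fps_nth ((fps_theta q ^^ Suc n) F) k =
        fps_nth F (n + Suc k) * (((1 - q ^ Suc k) / q ^ k) * (\<Prod>i<n. (1 - q ^ Suc (Suc k + i)) / q ^ (Suc k + i)))"
      by (simp add: fps_theta_def Suc.IH)
    thus ?case
      by (subst prod.lessThan_Suc_shift) simp
  qed simp
  from this[of 0] show ?thesis
    by (simp add: qpoch_q_q_eq prod_dividef)
qed

text \<open>The new series at \<open>z\<close> is a combination of shifted series of
  \<open>F\<close> at \<open>z / q\<close> and at \<open>z\<close>. Passing to \<open>z / q\<close>
  costs a factor \<open>norm q\<close> in the radius, so convergence everywhere is the property that
  survives any number of iterations.\<close>

lemma summable_fps_theta:
  fixes q :: complex
  assumes q: "q \<noteq> 0" "norm q < 1" and F: "\<And>z. summable (\<lambda>k. fps_nth F k * z ^ k)"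
  shows "summable (\<lambda>k. fps_nth (fps_theta q F) k * z ^ k)"
proof -
  define w where "w = z / q"
  have *: "summable (\<lambda>k. fps_nth F (Suc k) * v ^ k)" for v
    using powser_split_head(3)[OF F] .
  have "summable (\<lambda>k. fps_nth F (Suc k) * w ^ k - q * (fps_nth F (Suc k) * z ^ k))"
    by (intro summable_diff summable_mult *)
  also have "(\<lambda>k. fps_nth F (Suc k) * w ^ k - q * (fps_nth F (Suc k) * z ^ k)) =
             (\<lambda>k. fps_nth (fps_theta q F) k * z ^ k)"
    using q by (auto simp: fun_eq_iff w_def fps_theta_def field_simps)
  finally show ?thesis .
qed

lemma summable_fps_theta_funpow:
  fixes q :: complex
  assumes q: "q \<noteq> 0" "norm q < 1" and F: "\<And>z. summable (\<lambda>k. fps_nth F k * z ^ k)"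
  shows "summable (\<lambda>k. fps_nth ((fps_theta q ^^ n) F) k * z ^ k)"
proof (induction n arbitrary: z)
  case (Suc n)
  show ?case
    using summable_fps_theta[OF q Suc.IH] by simp
qed (use F in simp)

section \<open>Growth estimates and the choice of a circle\<close>

text \<open>The product is t^(n(n-1)/2) K^n. Consecutive majorants have ratio
  \<open>t ^ n * K * norm z\<close>, which tends to 0 for every \<open>z\<close>.\<close>

lemma summable_gaussian_powser:
  fixes z :: complex and x :: "nat \<Rightarrow> complex"
  assumes t: "0 < t" "t < 1" and K: "K > 0"
    and x: "\<And>n. norm (x n) \<le> C * (\<Prod>m<n. t ^ m * K)"
  shows "summable (\<lambda>n. x n * z ^ n)"
proof -
  define e where "e = (\<lambda>n. (\<Prod>m<n. t ^ m * K) * norm z ^ n)"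
  have "(\<lambda>n. t ^ n * K * norm z) \<longlonglongrightarrow> 0 * K * norm z"
    using t by (intro tendsto_intros LIMSEQ_power_zero) auto
  hence "eventually (\<lambda>n. t ^ n * K * norm z < 1 / 2) sequentially"
    by (rule order_tendstoD) auto
  then obtain N where N: "\<And>n. n \<ge> N \<Longrightarrow> t ^ n * K * norm z < 1 / 2"
    by (auto simp: eventually_sequentially)
  have e0: "e n \<ge> 0" for n
    using t K by (auto simp: e_def intro!: mult_nonneg_nonneg prod_nonneg)
  have "summable e"
  proof (rule summable_ratio_test[where N = N and c = "1 / 2"])
    fix n assume n: "n \<ge> N"
    have "e (Suc n) = (t ^ n * K * norm z) * e n"
      by (simp add: e_def)
    also have "\<dots> \<le> 1 / 2 * e n"
      using N[OF n] e0 by (intro mult_right_mono) auto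
    finally show "norm (e (Suc n)) \<le> 1 / 2 * norm (e n)"
      using e0 by simp
  qed simp
  hence "summable (\<lambda>n. C * e n)"
    by (rule summable_mult)
  thus ?thesis
  proof (rule summable_comparison_test')
    fix n
    have "norm (x n) * norm z ^ n \<le> C * (\<Prod>m<n. t ^ m * K) * norm z ^ n"
      by (intro mult_right_mono x) auto
    thus "norm (x n * z ^ n) \<le> C * e n"
      by (simp add: e_def norm_mult norm_power mult.assoc)
  qed
qed

text \<open>The points \<open>- (q ^ m)\<close> lie on the circles of radius
  \<open>norm q ^ m\<close>. A circle strictly between two consecutive ones keeps a distance from
  all these points that is uniform in \<open>m\<close>.\<close>

lemma circle_away_from_powers:
  fixes q :: complex
  assumes q: "0 < norm q" "norm q < 1" and s: "s > 0"
  obtains \<rho> \<delta> where "0 < \<rho>" "\<rho> < s" "0 < \<delta>" "\<And>a m. norm a = \<rho> \<Longrightarrow> \<delta> \<le> norm (a + q ^ m)"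
proof -
  define t where "t = norm q"
  have t: "0 < t" "t < 1" using q by (auto simp: t_def)
  obtain M where M: "t ^ M < s"
    using real_arch_pow_inv[OF s t(2)] by auto
  \<comment> \<open>\<open>\<rho>\<close> is the midpoint of \<open>t ^ Suc M\<close> and
    \<open>t ^ M\<close>, and \<open>\<delta>\<close> is half the gap between them.\<close>
  define \<delta> where "\<delta> = t ^ M * ((1 - t) / 2)"
  define \<rho> where "\<rho> = t ^ M * ((1 + t) / 2)"
  have eq: "t ^ M - \<rho> = \<delta>" "\<rho> - t ^ Suc M = \<delta>"
    by (simp_all add: \<delta>_def \<rho>_def field_simps)
  have \<delta>: "\<delta> > 0" and \<rho>: "\<rho> > 0"
    using t by (auto simp: \<delta>_def \<rho>_def)
  have "\<delta> \<le> norm (a + q ^ m)" if a: "norm a = \<rho>" for a m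
  proof -
    have "\<delta> \<le> \<bar>\<rho> - t ^ m\<bar>"
    proof (cases "m \<le> M")
      case True
      hence "t ^ M \<le> t ^ m" using t by (intro power_decreasing) auto
      thus ?thesis using eq by linarith
    next
      case False
      hence "t ^ m \<le> t ^ Suc M" using t by (intro power_decreasing) auto
      thus ?thesis using eq by linarith
    qed
    also have "\<rho> - t ^ m = norm a - norm (- (q ^ m))"
      using a by (simp add: t_def norm_power)
    also have "\<bar>\<dots>\<bar> \<le> norm (a - (- (q ^ m)))"
      by (rule norm_triangle_ineq3)
    finally show ?thesis by simp
  qed
  thus ?thesis
    using that[of \<rho> \<delta>] \<rho> \<delta> eq M by simp
qed

text \<open>At half the radius the terms are dominated by a geometric series of ratio 1/2, which
  gives a constant independent of \<open>a\<close>.\<close>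

lemma powser_bound_half_radius:
  fixes x :: "nat \<Rightarrow> complex"
  assumes s: "s > 0" and x: "\<And>i. norm (x i) \<le> C / s ^ i"
    and a: "norm a \<le> s / 2" and S: "(\<lambda>i. x i * a ^ i) sums S"
  shows "norm S \<le> 2 * C"
proof -
  have C: "0 \<le> C"
    using order_trans[OF norm_ge_zero x[of 0]] by simp
  have le: "norm (x i * a ^ i) \<le> C * (1 / 2) ^ i" for i
  proof -
    have "norm (x i * a ^ i) \<le> (C / s ^ i) * (s / 2) ^ i"
      unfolding norm_mult norm_power using s C by (intro mult_mono x power_mono a) auto
    thus ?thesis using s by (simp add: field_simps)
  qed
  have geo: "(\<lambda>i. C * (1 / 2) ^ i) sums (C * 2)"
    using sums_mult[OF geometric_sums[of "1 / 2 :: real"], of C] by simp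
  have "norm S \<le> (\<Sum>i. C * (1 / 2) ^ i)"
    unfolding sums_unique[OF S] using geo le
    by (intro norm_suminf_le) (auto simp: sums_iff)
  thus ?thesis using geo by (simp add: sums_iff)
qed

section \<open>The operator expansion on a small polydisc\<close>

theorem theorem2p2:
  fixes q :: complex
    and f :: "complex \<Rightarrow> complex \<Rightarrow> complex \<Rightarrow> complex"
    and U :: "(complex \<times> complex \<times> complex) set"
  assumes "0 < norm q" and "norm q < 1"
    and "open U" and "(0, 0, 0) \<in> U"
    and "analytic3_on f U"
    and "\<And>a b c. (a, b, c) \<in> U \<Longrightarrow> (a, b * q, c * q) \<in> U \<Longrightarrow> (a, b, c * q) \<in> U \<Longrightarrow>
           (a, b * q, c) \<in> U \<Longrightarrow>
           c * (f a (b * q) (c * q) - f a b (c * q)) =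
           b * (f a (b * q) (c * q) - f a (b * q) c - a * f a b c + a * f a b (c * q))"
  shows "\<forall>\<^sub>F (a, b, c) in nhds (0, 0, 0). a \<noteq> 0 \<longrightarrow>
           (\<forall>n. summable (\<lambda>k. fps_nth (theta_series q n (\<lambda>z. f a 0 z)) k * c ^ k)) \<and>
           f a b c = T_op q (- 1 / a) (a * b) (\<lambda>z. f a 0 z) c \<and>
           (\<lambda>n. qpoch (- 1 / a) q n / qpoch q q n * (a * b) ^ n * theta_pow q n (\<lambda>z. f a 0 z) c)
             sums f a b c"
proof -
  have q: "q \<noteq> 0" "norm q < 1"
    using assms(1,2) by auto
  have qmult: "norm (z * q) \<le> norm z" for z
    using q mult_left_mono[of "norm q" 1 "norm z"] by (simp add: norm_mult)
  obtain A r\<^sub>1 where r\<^sub>1: "r\<^sub>1 > 0" and A: "\<And>a b c. norm a < r\<^sub>1 \<Longrightarrow> norm b < r\<^sub>1 \<Longrightarrow> norm c < r\<^sub>1 \<Longrightarrow>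
      ((\<lambda>(i, j, k). A i j k * a ^ i * b ^ j * c ^ k) has_sum f a b c) UNIV"
    using assms(4,5) unfolding analytic3_on_def analytic3_at_def by fastforce
  obtain r\<^sub>2 where r\<^sub>2: "r\<^sub>2 > 0" and U: "\<And>a b c. norm a < r\<^sub>2 \<Longrightarrow> norm b < r\<^sub>2 \<Longrightarrow> norm c < r\<^sub>2 \<Longrightarrow> (a, b, c) \<in> U"
  proof -
    obtain V1 V2 where V: "open V1" "open V2" "(0, 0, 0) \<in> V1 \<times> V2" "V1 \<times> V2 \<subseteq> U"
      using open_prod_elim[OF assms(3,4)] by metis
    obtain V3 V4 where V': "open V3" "open V4" "(0, 0) \<in> V3 \<times> V4" "V3 \<times> V4 \<subseteq> V2"
      using open_prod_elim[of V2 "(0,0)"] V by (metis mem_Sigma_iff)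
    obtain e1 e2 e3 where "e1 > 0" "ball 0 e1 \<subseteq> V1" "e2 > 0" "ball 0 e2 \<subseteq> V3" "e3 > 0" "ball 0 e3 \<subseteq> V4"
      using V V' by (metis mem_Sigma_iff openE)
    with V V' show ?thesis
      by (intro that[of "min e1 (min e2 e3)"]) (auto simp: subset_iff)
  qed
  \<comment> \<open>Within this radius both the triple series and the functional equation are
    available; by \<open>qmult\<close>, scaling \<open>b\<close> and \<open>c\<close> by
    \<open>q\<close> stays inside.\<close>
  define r where "r = min r\<^sub>1 r\<^sub>2"
  have r: "r > 0" "r \<le> r\<^sub>1" "r \<le> r\<^sub>2"
    using r\<^sub>1 r\<^sub>2 by (auto simp: r_def)
  have A': "((\<lambda>(i, j, k). A i j k * a ^ i * b ^ j * c ^ k) has_sum f a b c) UNIV"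
    if "norm a < r" "norm b < r" "norm c < r" for a b c
    using A that r by force
  have feq: "c * (f a (b * q) (c * q) - f a b (c * q)) =
             b * (f a (b * q) (c * q) - f a (b * q) c - a * f a b c + a * f a b (c * q))"
    if "norm a < r" "norm b < r" "norm c < r" for a b c
    by (rule assms(6); rule U) (use that r qmult[of b] qmult[of c] in linarith)+
  obtain B G where
    B: "\<And>a j k. norm a < r \<Longrightarrow> (\<lambda>i. A i j k * a ^ i) sums B a j k" and
    G: "\<And>a j c. norm a < r \<Longrightarrow> norm c < r \<Longrightarrow> (\<lambda>k. B a j k * c ^ k) sums G a j c" and
    F: "\<And>a b c. norm a < r \<Longrightarrow> norm b < r \<Longrightarrow> norm c < r \<Longrightarrow> (\<lambda>j. G a j c * b ^ j) sums f a b c"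
  proof (rule triple_power_series_iterated[OF r(1) A'], goal_cases)
    case prems: (4 B G)
    show ?case by (rule prems(1)[of B G]) (rule prems(2-4); assumption)+
  qed
  define P where "P = (\<lambda>a n. \<Prod>m<n. a + q ^ m)"
  have qq: "qpoch q q n \<noteq> 0" for n
    using one_minus_power_nonzero[OF q(2)] by (simp add: qpoch_q_q_eq)
  have coeff: "B a n k = P a n / qpoch q q n * fps_nth ((fps_theta q ^^ n) (Abs_fps (B a 0))) k"
    if a: "norm a < r" for a n k
    unfolding P_def
    by (rule theta_recurrence_solution[OF q(2)],
        rule q_functional_equation_coeffs[OF r(1) q(2,1) G[OF a] F[OF a] feq[OF a]])
  \<comment> \<open>At \<open>b = 0\<close> only the term \<open>j = 0\<close> of the expansion in
    \<open>b\<close> remains, so \<open>B a 0\<close> consists of the Taylor coefficients on which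
    theta acts.\<close>
  have expansion: "fps_expansion (\<lambda>z. f a 0 z) 0 = Abs_fps (B a 0)" if a: "norm a < r" for a
  proof (intro fps_expansion_eqI has_fps_expansionI)
    have "f a 0 c = G a 0 c" if "norm c < r" for c
      using F[OF a _ that, of 0] r by simp
    hence "(\<lambda>k. B a 0 k * c ^ k) sums f a 0 c" if "norm c < r" for c
      using G[OF a that, of 0] that by simp
    thus "\<forall>\<^sub>F c in nhds 0. (\<lambda>k. fps_nth (Abs_fps (B a 0)) k * c ^ k) sums f a 0 c"
      unfolding eventually_nhds_metric using r(1) by (intro exI[of _ r]) auto
  qed

  \<comment> \<open>Two margins are taken: the point (s, s, s) is inside the polydisc, which bounds
    the terms there, and \<open>a\<close> is then kept within \<open>s / 2\<close> for the geometric
    series.\<close>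
  define s where "s = r / 2"
  have s: "s > 0" "s < r" using r by (auto simp: s_def)
  obtain M where M: "\<And>i j k. norm (A i j k * of_real s ^ i * of_real s ^ j * of_real s ^ k) \<le> M"
    using triple_power_series_coeff_bound[OF A'[of "of_real s" "of_real s" "of_real s"]] s by auto
  have B_bound: "norm (B a n 0) \<le> 2 * (M / s ^ n)" if a: "norm a \<le> s / 2" for a n
  proof (rule powser_bound_half_radius[OF s(1) _ a B])
    fix i
    show "norm (A i n 0) \<le> M / s ^ n / s ^ i"
      using M[of i n 0] s by (simp add: norm_mult norm_power field_simps)
  qed (use a s in simp)
  obtain \<rho> \<delta> where \<rho>: "0 < \<rho>" "\<rho> < s / 2" and \<delta>: "0 < \<delta>"
    and away: "\<And>a m. norm a = \<rho> \<Longrightarrow> \<delta> \<le> norm (a + q ^ m)"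
    using circle_away_from_powers[OF assms(1,2), of "s / 2"] s by auto

  \<comment> \<open>In the base \<open>1 / (\<delta> * s)\<close>, \<open>\<delta>\<close> comes
    from the lower bound for \<open>P a n\<close> on the circle and \<open>s\<close> from
    \<open>B_bound\<close>; the factors \<open>norm q ^ m\<close> come from the constant term of
    theta^n. Since \<open>P a n\<close> may vanish inside the circle, only the boundary is estimated
    directly.\<close>
  have B0_bound: "norm (B a 0 n) \<le> 2 * M * (\<Prod>m<n. norm q ^ m * (1 / (\<delta> * s)))"
    if a: "norm a \<le> \<rho>" for a n
  proof (rule maximum_modulus_frontier[of "\<lambda>a. B a 0 n" "cball 0 \<rho>"])
    have hol: "(\<lambda>a. B a 0 n) holomorphic_on ball 0 r"
      by (rule power_series_holomorphic[where a = "\<lambda>i. A i 0 n"]) (use B in simp)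
    show "(\<lambda>a. B a 0 n) holomorphic_on interior (cball 0 \<rho>)"
      by (rule holomorphic_on_subset[OF hol]) (use \<rho> s in auto)
    show "continuous_on (closure (cball 0 \<rho>)) (\<lambda>a. B a 0 n)"
      by (rule holomorphic_on_imp_continuous_on, rule holomorphic_on_subset[OF hol]) (use \<rho> s in auto)
  next
    fix a :: complex assume "a \<in> frontier (cball 0 \<rho>)"
    hence a: "norm a = \<rho>" using \<rho> by (simp add: frontier_cball)
    have "\<delta> ^ n \<le> norm (P a n)"
      unfolding P_def prod_norm[symmetric] using prod_mono[of "{..<n}" "\<lambda>_. \<delta>" "\<lambda>m. norm (a + q ^ m)"]
        away[OF a] \<delta> by simp
    hence "\<delta> ^ n * norm (B a 0 n) \<le> norm (P a n) * norm (B a 0 n)"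
      by (rule mult_right_mono) simp
    also have "norm (P a n) * norm (B a 0 n) = norm (\<Prod>m<n. q ^ m) * norm (B a n 0)"
    proof -
      \<comment> \<open>This is \<open>coeff\<close> at \<open>k = 0\<close>, where the two factors
        \<open>qpoch q q n\<close> cancel.\<close>
      have "P a n * B a 0 n = (\<Prod>m<n. q ^ m) * B a n 0"
        using coeff[of a n 0] a \<rho> s qq[of n] q
        by (simp add: fps_theta_funpow_nth_0 field_simps)
      thus ?thesis
        by (simp only: flip: norm_mult)
    qed
    also have "\<dots> \<le> norm (\<Prod>m<n. q ^ m) * (2 * (M / s ^ n))"
      by (intro mult_left_mono B_bound) (use a \<rho> in auto)
    finally have "norm (B a 0 n) \<le> 2 * M * (norm (\<Prod>m<n. q ^ m) * (1 / (\<delta> * s) ^ n))"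
      using \<delta> s by (simp add: field_simps)
    also have "norm (\<Prod>m<n. q ^ m) * (1 / (\<delta> * s) ^ n) = (\<Prod>m<n. norm q ^ m * (1 / (\<delta> * s)))"
      by (simp add: prod.distrib prod_norm[symmetric] norm_power power_one_over prod_dividef)
    finally show "norm (B a 0 n) \<le> 2 * M * (\<Prod>m<n. norm q ^ m * (1 / (\<delta> * s)))" .
  qed (use a in auto)

  have main: "(\<forall>n. summable (\<lambda>k. fps_nth (theta_series q n (\<lambda>z. f a 0 z)) k * c ^ k)) \<and>
           f a b c = T_op q (- 1 / a) (a * b) (\<lambda>z. f a 0 z) c \<and>
           (\<lambda>n. qpoch (- 1 / a) q n / qpoch q q n * (a * b) ^ n * theta_pow q n (\<lambda>z. f a 0 z) c)
             sums f a b c"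
    if abc: "norm a < \<rho>" "norm b < \<rho>" "norm c < \<rho>" and a0: "a \<noteq> 0" for a b c
  proof -
    have lt: "norm a < r" "norm b < r" "norm c < r"
      using abc \<rho> s by auto
    let ?\<theta> = "\<lambda>n. (fps_theta q ^^ n) (Abs_fps (B a 0))"
    have \<theta>: "theta_series q n (\<lambda>z. f a 0 z) = ?\<theta> n" for n
      by (simp add: theta_series_def expansion lt)
    \<comment> \<open>\<open>B0_bound\<close> holds on the whole disc, including the points
      \<open>- (q ^ m)\<close> in it, so the Taylor series in \<open>c\<close> is entire for each
      such \<open>a\<close>.\<close>
    have "summable (\<lambda>k. fps_nth (Abs_fps (B a 0)) k * z ^ k)" for z
      using summable_gaussian_powser[OF assms(1,2) _ B0_bound[of a], of z] abc \<delta> s by simp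
    hence summ: "summable (\<lambda>k. fps_nth (?\<theta> n) k * z ^ k)" for n z
      by (rule summable_fps_theta_funpow[OF q])
    \<comment> \<open>One factor \<open>a\<close> is absorbed into each factor
      \<open>1 + q ^ m / a\<close>, which is where \<open>a \<noteq> 0\<close> enters.\<close>
    have "qpoch (- 1 / a) q n * a ^ n = P a n" for n
      using a0 by (induction n) (simp_all add: qpoch_def P_def field_simps)
    moreover have "G a n c = P a n / qpoch q q n * theta_pow q n (\<lambda>z. f a 0 z) c" for n
    proof -
      have "(\<lambda>k. P a n / qpoch q q n * (fps_nth (?\<theta> n) k * c ^ k)) sums
              (P a n / qpoch q q n * theta_pow q n (\<lambda>z. f a 0 z) c)"
        unfolding theta_pow_def eval_fps_def \<theta> by (intro sums_mult summable_sums summ)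
      hence "(\<lambda>k. B a n k * c ^ k) sums (P a n / qpoch q q n * theta_pow q n (\<lambda>z. f a 0 z) c)"
        by (simp add: coeff[OF lt(1)] mult.assoc)
      thus ?thesis
        using G[OF lt(1,3), of n] sums_unique2 by blast
    qed
    ultimately have "G a n c * b ^ n =
        qpoch (- 1 / a) q n / qpoch q q n * (a * b) ^ n * theta_pow q n (\<lambda>z. f a 0 z) c" for n
      by (simp add: power_mult_distrib flip: \<open>\<And>n. qpoch (- 1 / a) q n * a ^ n = P a n\<close>)
    \<comment> \<open>The operator series is, term by term, the expansion of \<open>f\<close> in
      powers of \<open>b\<close>, so its convergence comes from \<open>F\<close>.\<close>
    hence "(\<lambda>n. qpoch (- 1 / a) q n / qpoch q q n * (a * b) ^ n * theta_pow q n (\<lambda>z. f a 0 z) c)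
             sums f a b c"
      using F[OF lt] by simp
    thus ?thesis
      using summ by (simp add: \<theta> T_op_def sums_iff)
  qed
  have "\<forall>\<^sub>F p in nhds (0, 0, 0). p \<in> ball (0::complex) \<rho> \<times> ball (0::complex) \<rho> \<times> ball (0::complex) \<rho>"
    by (rule eventually_nhds_in_open) (use \<rho> in \<open>auto intro!: open_Times\<close>)
  thus ?thesis
  proof (rule eventually_mono, unfold split_paired_all mem_Times_iff prod.case fst_conv snd_conv mem_ball_0,
         intro impI)
  qed (elim conjE; rule main; assumption)
qed

end
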